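(* For every countable graph $G$ not containing $K_\omega$ as a subgraph there exists a countable rigid graph $G'$ containing $G$ as an induced subgraph.
   Context: All graphs are simple, undirected and loopless. A homomorphism is a vertex map preserving edges. A graph $G'$ is rigid if the identity map is its only homomorphism $G' \to G'$. $K_\omega$ denotes the countably infinite complete graph. *)

theory Defs
  imports Main "HOL-Library.Countable_Set"
begin

definition simple_graph :: "'a set \<Rightarrow> ('a \<Rightarrow> 'a \<Rightarrow> bool) \<Rightarrow> bool" where
  "simple_graph V E \<longleftrightarrow>
     (\<forall>x y. E x y \<longrightarrow> x \<in> V \<and> y \<in> V) \<and>
     (\<forall>x y. E x y \<longrightarrow> E y x) \<and>
     (\<forall>x. \<not> E x x)"

definition graph_hom :: "'a set \<Rightarrow> ('a \<Rightarrow> 'a \<Rightarrow> bool) \<Rightarrow> 'b set \<Rightarrow> ('b \<Rightarrow> 'b \<Rightarrow> bool) \<Rightarrow> ('a \<Rightarrow> 'b) \<Rightarrow> bool" where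
  "graph_hom V E W F h \<longleftrightarrow> (\<forall>x\<in>V. h x \<in> W) \<and> (\<forall>x y. E x y \<longrightarrow> F (h x) (h y))"

definition rigid :: "'a set \<Rightarrow> ('a \<Rightarrow> 'a \<Rightarrow> bool) \<Rightarrow> bool" where
  "rigid V E \<longleftrightarrow> (\<forall>h. graph_hom V E V E h \<longrightarrow> (\<forall>x\<in>V. h x = x))"

definition contains_K_omega :: "'a set \<Rightarrow> ('a \<Rightarrow> 'a \<Rightarrow> bool) \<Rightarrow> bool" where
  "contains_K_omega V E \<longleftrightarrow>
     (\<exists>f :: nat \<Rightarrow> 'a. inj f \<and> (\<forall>n. f n \<in> V) \<and> (\<forall>m n. m \<noteq> n \<longrightarrow> E (f m) (f n)))"

definition induced_embedding :: "'a set \<Rightarrow> ('a \<Rightarrow> 'a \<Rightarrow> bool) \<Rightarrow> 'b set \<Rightarrow> ('b \<Rightarrow> 'b \<Rightarrow> bool) \<Rightarrow> ('a \<Rightarrow> 'b) \<Rightarrow> bool" where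
  "induced_embedding V E W F h \<longleftrightarrow> inj_on h V \<and> h ` V \<subseteq> W \<and>
     (\<forall>x\<in>V. \<forall>y\<in>V. E x y \<longleftrightarrow> F (h x) (h y))"

end

theory Submission
  imports Defs
begin

text \<open>
  Write \<open>G + K\<^sub>n\<close> for the join of \<open>G\<close> with a complete graph on \<open>n\<close> vertices. If \<open>G\<close> has no
  \<open>K\<^sub>\<omega>\<close>, then there is no homomorphism \<open>g\<close> from \<open>G + K\<^sub>n\<^sub>+\<^sub>1\<close> to \<open>G + K\<^sub>n\<close>: iterating \<open>g\<close> on the
  additional apex would give an infinite clique. Take a pentagon, and make each of its five
  vertices an apex over its own disjoint copies of \<open>G + K\<^sub>n\<close>, for all \<open>n\<close>. Add a ray whose vertices
  are joined to varying edges of the pentagon, and join every vertex of the copies to two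
  vertices of the ray, which are to determine it. The neighbourhood of a vertex outside the
  pentagon maps to some \<open>G + K\<^sub>m\<close>, and that of a pentagon vertex does not. Hence an endomorphism maps
  the pentagon to itself. The start of the ray excludes the nontrivial symmetries of the
  pentagon; then the ray is fixed inductively, and finally so are all the copies.
\<close>

section \<open>Joins with finite complete graphs\<close>

fun join_complete :: "(nat \<Rightarrow> nat \<Rightarrow> bool) \<Rightarrow> nat \<Rightarrow> nat + nat \<Rightarrow> nat + nat \<Rightarrow> bool" where
  "join_complete E n (Inl a) (Inl b) \<longleftrightarrow> E a b"
| "join_complete E n (Inl a) (Inr j) \<longleftrightarrow> j < n"
| "join_complete E n (Inr i) (Inl b) \<longleftrightarrow> i < n"
| "join_complete E n (Inr i) (Inr j) \<longleftrightarrow> i < n \<and> j < n \<and> i \<noteq> j"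

lemma join_complete_sym:
  assumes "simple_graph UNIV E" "join_complete E n x y"
  shows "join_complete E n y x"
  using assms by (cases x; cases y) (auto simp: simple_graph_def)

lemma join_complete_irrefl:
  assumes "simple_graph UNIV E"
  shows "\<not> join_complete E n x x"
  using assms by (cases x) (auto simp: simple_graph_def)

lemma join_complete_mono:
  assumes "join_complete E m x y" "m \<le> n"
  shows "join_complete E n x y"
  using assms by (cases x; cases y) auto

text \<open>In \<open>join_complete E m\<close> every \<open>Inr i\<close> with
  \<open>m \<le> i\<close> is an isolated dummy. A vertex with a neighbour there is thus adjacent to
  every apex that a larger join adds.\<close>

lemma join_complete_apex:
  assumes "join_complete E m x y" "m \<le> i" "i < n"
  shows "join_complete E n (Inr i) y" "join_complete E n y (Inr i)"
  using assms by (cases x; cases y; auto)+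

text \<open>At most \<open>m\<close> members of the clique are apexes; the others form an infinite
  clique of \<open>E\<close>.\<close>

lemma join_complete_no_infinite_clique:
  assumes G: "\<not> contains_K_omega UNIV E"
    and inj: "inj (x :: nat \<Rightarrow> _)" and clique: "\<And>i j. i \<noteq> j \<Longrightarrow> join_complete E m (x i) (x j)"
  shows False
proof -
  define B where "B = {k. \<exists>i. x k = Inr i}"
  have "x ` B \<subseteq> Inr ` {..<m}"
  proof
    fix y assume "y \<in> x ` B"
    then obtain k i where "y = x k" "x k = Inr i" by (auto simp: B_def)
    moreover have "join_complete E m (x k) (x (Suc k))" by (simp add: clique)
    ultimately show "y \<in> Inr ` {..<m}" by (cases "x (Suc k)") auto
  qed
  then have "finite B"
    using inj by (meson finite_imageD finite_imageI finite_lessThan finite_subset inj_on_subset subset_UNIV)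
  then have inf: "infinite (- B)" by (simp add: finite_compl)
  define e where "e = enumerate (- B)"
  have e: "inj e" "\<And>k. e k \<in> - B"
    unfolding e_def using strict_mono_enumerate[OF inf] enumerate_in_set[OF inf]
    by (simp_all only: strict_mono_imp_inj_on)
  define h where "h = (\<lambda>k. projl (x (e k)))"
  have h: "x (e k) = Inl (h k)" for k
    using e(2)[of k] by (cases "x (e k)") (auto simp: B_def h_def)
  have "inj h"
    by (rule injI) (metis h e(1) inj injD)
  moreover have "E (h i) (h j)" if "i \<noteq> j" for i j
    using clique[of "e i" "e j"] e(1) that by (simp add: h inj_eq)
  ultimately show False
    using G by (auto simp: contains_K_omega_def)
qed

lemma no_hom_join_complete_Suc:
  assumes simple: "simple_graph UNIV E" and G: "\<not> contains_K_omega UNIV E"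
    and hom: "\<And>x y. join_complete E (Suc m) x y \<Longrightarrow> join_complete E m (g x) (g y)"
  shows False
proof -
  \<comment> \<open>The orbit starts at \<open>g (Inr m)\<close> because \<open>Inr m\<close> itself
    is isolated in the smaller join.\<close>
  define x where "x k = (g ^^ Suc k) (Inr m)" for k
  have x0: "x 0 = g (Inr m)" and xS: "\<And>k. x (Suc k) = g (x k)"
    by (simp_all add: x_def)
  \<comment> \<open>Each \<open>x k\<close> has a neighbour in the smaller join, so the new apex
    \<open>Inr m\<close> is adjacent to it. Applying \<open>g\<close> to that edge joins
    \<open>x 0\<close> to \<open>x (Suc k)\<close>, and further applications shift both
    indices.\<close>
  have apex: "join_complete E (Suc m) (Inr m) (x k)" for k
  proof (induction k)
    case 0
    have "join_complete E m (g (Inl 0)) (x 0)"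
      unfolding x0 by (rule hom) simp
    then show ?case by (rule join_complete_apex) auto
  next
    case (Suc k)
    then have "join_complete E m (x 0) (x (Suc k))"
      unfolding x0 xS by (rule hom)
    then show ?case by (rule join_complete_apex) auto
  qed
  have step: "join_complete E m (x i) (x (Suc (i + k)))" for i k
  proof (induction i)
    case 0
    show ?case using hom[OF apex[of k]] by (simp add: x0 xS)
  next
    case (Suc i)
    then have "join_complete E (Suc m) (x i) (x (Suc (i + k)))"
      by (rule join_complete_mono) simp
    then show ?case using hom by (simp add: xS)
  qed
  have clique: "join_complete E m (x i) (x j)" if "i \<noteq> j" for i j
    using that
  proof (induction i j rule: linorder_wlog)
    case (le i j)
    then obtain k where "j = Suc (i + k)" by (metis less_iff_Suc_add order_le_less)
    then show ?case using step by simp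
  next
    case (sym i j)
    then show ?case using join_complete_sym[OF simple] by blast
  qed
  have "inj x"
    by (rule injI) (metis clique join_complete_irrefl[OF simple])
  then show False
    using join_complete_no_infinite_clique[OF G] clique by blast
qed

section \<open>The marked pentagon\<close>

datatype pent = A0 | A1 | A2 | A3 | A4

instance pent :: countable
  by countable_datatype

definition cyc :: "pent \<Rightarrow> pent \<Rightarrow> bool" where
  "cyc a b \<longleftrightarrow> (a, b) \<in> {(A0, A1), (A1, A2), (A2, A3), (A3, A4), (A4, A0),
                          (A1, A0), (A2, A1), (A3, A2), (A4, A3), (A0, A4)}"

text \<open>Only the start of the ray gets three marks, which makes it recognisable. The edges for
  residues 1 and 2 are disjoint, which later keeps the images of copy vertices out of the
  pentagon.\<close>

definition mark :: "nat \<Rightarrow> pent set" where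
  "mark k = (if k = 0 then {A0, A1, A2}
             else if k mod 3 = 1 then {A2, A3}
             else if k mod 3 = 2 then {A4, A0} else {A1, A2})"

lemma cyc_sym: "cyc a b \<longleftrightarrow> cyc b a"
  by (auto simp: cyc_def)

lemma cyc_triangle_free: "cyc a b \<Longrightarrow> cyc a c \<Longrightarrow> cyc b c \<Longrightarrow> False"
  by (auto simp: cyc_def)

lemma mark_edge:
  obtains a b where "cyc a b" "mark (Suc k) = {a, b}"
proof -
  have "cyc A2 A3" "cyc A4 A0" "cyc A1 A2" by (simp_all add: cyc_def)
  then show ?thesis using that unfolding mark_def by (metis nat.distinct(1))
qed

text \<open>This keeps the image of the ray from turning back one step.\<close>

lemma mark_not_subset: "\<not> mark (Suc (Suc k)) \<subseteq> mark k"
proof -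
  consider "k mod 3 = 0" | "k mod 3 = 1" | "k mod 3 = 2" by linarith
  then show ?thesis
    by cases (auto simp: mark_def mod_Suc)
qed

text \<open>The images of \<open>A0\<close>, \<open>A1\<close>, \<open>A2\<close> are distinct,
  since \<open>r A0 = r A2\<close> would close a triangle through \<open>r A3\<close> and
  \<open>r A4\<close>; so \<open>mark k\<close> has three elements. Then \<open>mark 0\<close> and
  \<open>mark 1\<close> meet only in \<open>A2\<close>, which is therefore fixed, and adjacency
  forces the rest.\<close>

lemma pent_hom_trivial:
  assumes hom: "\<And>a b. cyc a b \<Longrightarrow> cyc (r a) (r b)"
    and mark0: "r ` mark 0 \<subseteq> mark k" and mark1: "k = 0 \<Longrightarrow> r ` mark 1 \<subseteq> mark 1"
  shows "k = 0" "r a = a"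
proof -
  have e: "cyc (r A0) (r A1)" "cyc (r A1) (r A2)" "cyc (r A2) (r A3)"
    "cyc (r A3) (r A4)" "cyc (r A4) (r A0)"
    by (rule hom, simp add: cyc_def)+
  have "r A0 \<noteq> r A1" "r A1 \<noteq> r A2"
    using e(1,2) by (auto simp: cyc_def)
  moreover have "r A0 \<noteq> r A2"
    using e(3-5) cyc_triangle_free by (metis cyc_sym)
  ultimately show k: "k = 0"
    using mark0 by (auto simp: mark_def split: if_splits)
  have m: "r A0 \<in> {A0, A1, A2}" "r A1 \<in> {A0, A1, A2}" "r A2 \<in> {A0, A1, A2}"
    "r A2 \<in> {A2, A3}" "r A3 \<in> {A2, A3}"
    using mark0 mark1 k by (auto simp: mark_def)
  have r2: "r A2 = A2" using m(3,4) by auto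
  have r3: "r A3 = A3" using m(5) e(3) r2 by (auto simp: cyc_def)
  have r1: "r A1 = A1" using m(2) e(2) r2 by (auto simp: cyc_def)
  have r0: "r A0 = A0" using m(1) e(1) r1 r2 \<open>r A0 \<noteq> r A2\<close> by (auto simp: cyc_def)
  have r4: "r A4 = A4" using e(4,5) r3 r0 by (auto simp: cyc_def)
  show "r a = a"
    using r0 r1 r2 r3 r4 by (cases a) auto
qed

section \<open>The extended graph and its neighbourhoods\<close>

datatype vertex = Con pent | Path nat | Copy pent nat "nat + nat"

instance vertex :: countable
  by countable_datatype

definition slot :: "pent \<Rightarrow> nat \<Rightarrow> nat + nat \<Rightarrow> nat" where
  "slot c n u = to_nat (c, n, u)"

lemma slot_eq_iff [simp]: "slot c n u = slot c' n' u' \<longleftrightarrow> c = c' \<and> n = n' \<and> u = u'"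
  by (simp add: slot_def)

text \<open>The blocks of six are disjoint, so a ray vertex serves at most one slot. The two
  positions differ by 4, so no ray vertex is adjacent to both; their residues 1 and 2 modulo 3 give
  disjoint marks, so no pentagon vertex is either.\<close>

definition attached :: "nat \<Rightarrow> nat \<Rightarrow> bool" where
  "attached s k \<longleftrightarrow> k = 6 * s + 1 \<or> k = 6 * s + 5"

lemma attached_unique: "attached s k \<Longrightarrow> attached t k \<Longrightarrow> s = t"
  unfolding attached_def by presburger

fun edge :: "(nat \<Rightarrow> nat \<Rightarrow> bool) \<Rightarrow> vertex \<Rightarrow> vertex \<Rightarrow> bool" where
  "edge E (Con c) (Con d) \<longleftrightarrow> cyc c d"
| "edge E (Con c) (Path k) \<longleftrightarrow> c \<in> mark k"
| "edge E (Con c) (Copy d n u) \<longleftrightarrow> c = d"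
| "edge E (Path k) (Con c) \<longleftrightarrow> c \<in> mark k"
| "edge E (Path k) (Path l) \<longleftrightarrow> k = Suc l \<or> l = Suc k"
| "edge E (Path k) (Copy d n u) \<longleftrightarrow> attached (slot d n u) k"
| "edge E (Copy d n u) (Con c) \<longleftrightarrow> c = d"
| "edge E (Copy d n u) (Path k) \<longleftrightarrow> attached (slot d n u) k"
| "edge E (Copy d n u) (Copy d' n' u') \<longleftrightarrow> d = d' \<and> n = n' \<and> join_complete E n u u'"

lemma simple_graph_edge:
  assumes "simple_graph UNIV E"
  shows "simple_graph UNIV (edge E)"
proof -
  have "edge E y x" if "edge E x y" for x y
    using that join_complete_sym[OF assms]
    by (cases x; cases y) (auto simp: cyc_def)
  moreover have "\<not> edge E x x" for x
    using join_complete_irrefl[OF assms] by (cases x) (auto simp: cyc_def)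
  ultimately show ?thesis by (auto simp: simple_graph_def)
qed

text \<open>Eight colours suffice: five for the pentagon, two for the ray neighbours, and one for
  the at most one attached copy vertex.\<close>

lemma neighbourhood_Path:
  assumes "simple_graph UNIV E"
  obtains g where
    "\<And>y z. edge E (Path k) y \<Longrightarrow> edge E (Path k) z \<Longrightarrow> edge E y z \<Longrightarrow>
      join_complete E 8 (g y) (g z)"
proof
  define g :: "vertex \<Rightarrow> nat + nat" where
    "g = (\<lambda>y. case y of Con c \<Rightarrow> Inr (case c of A0 \<Rightarrow> 0 | A1 \<Rightarrow> 1 | A2 \<Rightarrow> 2 | A3 \<Rightarrow> 3 | A4 \<Rightarrow> 4)
      | Path l \<Rightarrow> Inr (if l < k then 5 else 6) | Copy c n u \<Rightarrow> Inr 7)"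
  fix y z
  assume "edge E (Path k) y" "edge E (Path k) z" "edge E y z"
  then show "join_complete E 8 (g y) (g z)"
    using attached_unique join_complete_irrefl[OF assms]
    by (cases y; cases z) (fastforce simp: g_def cyc_def split: pent.splits)+
qed

text \<open>Besides its own copy the vertex sees one pentagon vertex and two ray vertices, which
  become three new apexes.\<close>

lemma neighbourhood_Copy:
  assumes "simple_graph UNIV E"
  obtains g where
    "\<And>y z. edge E (Copy c n u) y \<Longrightarrow> edge E (Copy c n u) z \<Longrightarrow> edge E y z \<Longrightarrow>
      join_complete E (n + 3) (g y) (g z)"
proof
  define g :: "vertex \<Rightarrow> nat + nat" where
    "g = (\<lambda>y. case y of Con c \<Rightarrow> Inr n
      | Path l \<Rightarrow> Inr (if l = 6 * slot c n u + 1 then n + 1 else n + 2) | Copy c n u \<Rightarrow> u)"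
  fix y z
  assume "edge E (Copy c n u) y" "edge E (Copy c n u) z" "edge E y z"
  then show "join_complete E (n + 3) (g y) (g z)"
    by (cases y; cases z)
      (auto simp: g_def cyc_def attached_def intro: join_complete_apex join_complete_mono)
qed

section \<open>Rigidity\<close>

lemma hom_Con:
  assumes simple: "simple_graph UNIV E" and G: "\<not> contains_K_omega UNIV E"
    and hom: "\<And>x y. edge E x y \<Longrightarrow> edge E (f x) (f y)"
  obtains d where "f (Con c) = Con d"
proof -
  \<comment> \<open>The bound \<open>m\<close> depends on where \<open>f\<close> sends
    \<open>Con c\<close>. Since \<open>Con c\<close> is an apex over copies of every size, the copy
    with \<open>Suc m\<close> apexes can be chosen afterwards.\<close>
  have no: False
    if g: "\<And>y z. edge E (f (Con c)) y \<Longrightarrow> edge E (f (Con c)) z \<Longrightarrow> edge E y z \<Longrightarrow>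
      join_complete E m (g y) (g z)" for g m
  proof (rule no_hom_join_complete_Suc[OF simple G])
    fix x y
    assume "join_complete E (Suc m) x y"
    then show "join_complete E m (g (f (Copy c (Suc m) x))) (g (f (Copy c (Suc m) y)))"
      by (intro g hom) auto
  qed
  show ?thesis
  proof (cases "f (Con c)")
    case (Con d)
    then show ?thesis by (rule that)
  next
    case (Path k)
    then show ?thesis using neighbourhood_Path[OF simple] no by metis
  next
    case (Copy d n u)
    then show ?thesis using neighbourhood_Copy[OF simple] no by metis
  qed
qed

text \<open>The pentagon has no triangle, and a copy vertex sees only one pentagon vertex.\<close>

lemma common_neighbour_Con_edge:
  assumes "edge E (Con a) x" "edge E (Con b) x" "cyc a b"
  obtains k where "x = Path k" "a \<in> mark k" "b \<in> mark k"
  using assms by (cases x) (auto simp: cyc_def)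

lemma rigid_edge:
  assumes simple: "simple_graph UNIV E" and G: "\<not> contains_K_omega UNIV E"
  shows "rigid UNIV (edge E)"
  unfolding rigid_def
proof (intro allI impI ballI)
  fix f x
  assume "graph_hom UNIV (edge E) UNIV (edge E) f"
  then have hom: "edge E (f x) (f y)" if "edge E x y" for x y
    using that by (auto simp: graph_hom_def)
  obtain r where r: "\<And>c. f (Con c) = Con (r c)"
  proof -
    have "\<exists>d. f (Con c) = Con d" for c
      by (rule hom_Con[OF simple G, of f]) (use hom in auto)
    then show ?thesis using that by metis
  qed
  have r_hom: "cyc (r a) (r b)" if "cyc a b" for a b
    using hom[of "Con a" "Con b"] that by (simp add: r)
  have marked: "edge E (Con (r c)) (f (Path k))" if "c \<in> mark k" for c k
    using hom[of "Con c" "Path k"] that by (simp add: r)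
  \<comment> \<open>Every mark set contains an edge of the pentagon, whose image has common
    neighbours only on the ray.\<close>
  have f_Path: "\<exists>l. f (Path k) = Path l \<and> r ` mark k \<subseteq> mark l" for k
  proof -
    obtain a b where ab: "a \<in> mark k" "b \<in> mark k" "cyc a b"
    proof (cases k)
      case 0
      have "A0 \<in> mark k" "A1 \<in> mark k" "cyc A0 A1" by (simp_all add: mark_def cyc_def 0)
      then show ?thesis by (rule that)
    next
      case (Suc j)
      then show ?thesis using mark_edge[of j] that by (metis insertI1 insertI2)
    qed
    then obtain l where "f (Path k) = Path l"
      using common_neighbour_Con_edge marked r_hom by metis
    then show ?thesis using marked[of _ k] by auto
  qed
  obtain k where k: "f (Path 0) = Path k" "r ` mark 0 \<subseteq> mark k"
    using f_Path by blast
  have "r ` mark 1 \<subseteq> mark 1" if "k = 0"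
  proof -
    obtain l where l: "f (Path 1) = Path l" "r ` mark 1 \<subseteq> mark l"
      using f_Path by blast
    moreover have "edge E (f (Path 0)) (f (Path 1))" by (rule hom) simp
    ultimately show ?thesis using k that by simp
  qed
  note trivial = pent_hom_trivial[OF r_hom k(2) this]
  have Con: "f (Con c) = Con c" for c
    using r trivial by simp
  have Path: "f (Path j) = Path j" for j
  proof (induction j)
    case 0
    show ?case using k trivial by simp
  next
    case (Suc j)
    obtain l where l: "f (Path (Suc j)) = Path l" "mark (Suc j) \<subseteq> mark l"
      using f_Path[of "Suc j"] trivial by auto
    have "edge E (f (Path j)) (f (Path (Suc j)))" by (rule hom) simp
    then have "l = Suc j \<or> j = Suc l" using Suc l by auto
    then show ?case using l mark_not_subset by auto
  qed
  show "f x = x"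
  proof (cases x)
    case (Copy c n u)
    define s where "s = slot c n u"
    have "edge E (f (Path (6 * s + 1))) (f x)" "edge E (f (Path (6 * s + 5))) (f x)"
      by (rule hom; simp add: Copy s_def attached_def)+
    then have e: "edge E (Path (6 * s + 1)) (f x)" "edge E (Path (6 * s + 5)) (f x)"
      by (simp_all only: Path)
    show ?thesis
    \<comment> \<open>The image is a common neighbour of the two ray vertices attached to
      \<open>x\<close>, and \<open>x\<close> is the only one.\<close>
    proof (cases "f x")
      case (Con d)
      have "(6 * s + 1) mod 3 = 1" "(6 * s + 5) mod 3 = 2" by presburger+
      then show ?thesis using e Con by (auto simp: mark_def)
    next
      case (Path l)
      then show ?thesis using e by auto
    next
      case (Copy d m v)
      have "attached s (6 * s + 1)" by (simp add: attached_def)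
      then have "slot d m v = s"
        using e Copy attached_unique by simp
      then show ?thesis using Copy \<open>x = _\<close> by (simp add: s_def)
    qed
  qed (auto simp: Con Path)
qed

text \<open>The join with no apexes is \<open>E\<close> plus isolated dummies; any pentagon vertex
  would do for \<open>A0\<close>.\<close>

lemma induced_embedding_Copy:
  "induced_embedding UNIV E UNIV (edge E) (\<lambda>v. Copy A0 0 (Inl v))"
  by (auto simp: induced_embedding_def inj_on_def)

section \<open>Transport along injections\<close>

definition image_graph :: "('a \<Rightarrow> 'b) \<Rightarrow> ('a \<Rightarrow> 'a \<Rightarrow> bool) \<Rightarrow> 'b \<Rightarrow> 'b \<Rightarrow> bool" where
  "image_graph g E x y \<longleftrightarrow> (\<exists>a b. E a b \<and> x = g a \<and> y = g b)"

lemma image_graph_iff: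
  assumes "simple_graph V E" "inj_on g V" "a \<in> V" "b \<in> V"
  shows "image_graph g E (g a) (g b) \<longleftrightarrow> E a b"
  using assms unfolding image_graph_def simple_graph_def by (metis inj_onD)

lemma simple_graph_image:
  assumes "simple_graph V E" "inj_on g V" "g ` V \<subseteq> W"
  shows "simple_graph W (image_graph g E)"
proof -
  have V: "a \<in> V" "b \<in> V" "E b a" if "E a b" for a b
    using assms(1) that by (auto simp: simple_graph_def)
  have "\<not> image_graph g E x x" for x
    using V assms by (auto simp: image_graph_def simple_graph_def dest: inj_onD)
  moreover have "image_graph g E y x" "x \<in> W" "y \<in> W" if "image_graph g E x y" for x y
    using that V assms(3) unfolding image_graph_def by blast+
  ultimately show ?thesis by (auto simp: simple_graph_def)
qed

text \<open>\<open>W\<close> may contain extra vertices, but these are isolated and so lie in no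
  clique of size two or more.\<close>

lemma contains_K_omega_image_graphD:
  assumes "simple_graph V E" "contains_K_omega W (image_graph g E)" "inj_on g V"
  shows "contains_K_omega V E"
proof -
  obtain f :: "nat \<Rightarrow> _" where f: "inj f" "\<And>m n. m \<noteq> n \<Longrightarrow> image_graph g E (f m) (f n)"
    using assms(2) by (auto simp: contains_K_omega_def)
  have "\<exists>a\<in>V. f n = g a" for n
    using f(2)[of n "Suc n"] assms(1) by (auto simp: image_graph_def simple_graph_def)
  then obtain h where h: "\<And>n. h n \<in> V" "\<And>n. f n = g (h n)" by metis
  have "inj h" by (rule injI) (metis f(1) h(2) injD)
  moreover have "E (h m) (h n)" if "m \<noteq> n" for m n
    using f(2)[OF that] h image_graph_iff[OF assms(1,3)] by metis
  ultimately show ?thesis using h(1) by (auto simp: contains_K_omega_def)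
qed

lemma rigid_image_graph:
  assumes "simple_graph V E" "rigid V E" "inj_on g V"
  shows "rigid (g ` V) (image_graph g E)"
  unfolding rigid_def
proof (intro allI impI ballI)
  fix h x
  assume h: "graph_hom (g ` V) (image_graph g E) (g ` V) (image_graph g E) h" and "x \<in> g ` V"
  then obtain a where a: "a \<in> V" "x = g a" by auto
  define k where "k = (\<lambda>b. inv_into V g (h (g b)))"
  have k: "k b \<in> V" "g (k b) = h (g b)" if "b \<in> V" for b
    using h that by (auto simp: graph_hom_def k_def inv_into_into f_inv_into_f)
  have "E (k b) (k c)" if "E b c" for b c
  proof -
    have bc: "b \<in> V" "c \<in> V" using assms(1) that by (auto simp: simple_graph_def)
    have "image_graph g E (h (g b)) (h (g c))"
      using h that unfolding graph_hom_def image_graph_def by blast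
    then show ?thesis
      using k[OF bc(1)] k[OF bc(2)] image_graph_iff[OF assms(1,3)] by metis
  qed
  then have "graph_hom V E V E k" using k by (auto simp: graph_hom_def)
  then have "k a = a" using assms(2) a by (auto simp: rigid_def)
  then show "h x = x" using k(2) a by metis
qed

lemma induced_embedding_image_graph:
  assumes "simple_graph V E" "inj_on g V" "g ` V \<subseteq> W"
  shows "induced_embedding V E W (image_graph g E) g"
  using assms image_graph_iff[OF assms(1,2)] by (auto simp: induced_embedding_def)

lemma induced_embedding_comp:
  assumes "induced_embedding V E W F g" "induced_embedding W F X H h"
  shows "induced_embedding V E X H (h \<circ> g)"
  using assms unfolding induced_embedding_def
  by (auto intro: comp_inj_on inj_on_subset simp: image_subset_iff)

theorem theorem4:
  fixes V :: "'a set" and E :: "'a \<Rightarrow> 'a \<Rightarrow> bool"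
  assumes "simple_graph V E" and "countable V" and "\<not> contains_K_omega V E"
  shows "\<exists>(V' :: nat set) E' h. simple_graph V' E' \<and> rigid V' E' \<and>
           induced_embedding V E V' E' h"
proof -
  \<comment> \<open>The graph is moved to all of \<open>nat\<close>, possibly with added isolated
    vertices; these do no harm inside the rigid graph built next.\<close>
  define g where "g = to_nat_on V"
  define F where "F = image_graph g E"
  have g: "inj_on g V" using assms(2) by (simp add: g_def inj_on_to_nat_on)
  have simple: "simple_graph UNIV F"
    unfolding F_def by (rule simple_graph_image[OF assms(1) g]) simp
  have "\<not> contains_K_omega UNIV F"
    using contains_K_omega_image_graphD[OF assms(1) _ g] assms(3) by (auto simp: F_def)
  then have rigid: "rigid UNIV (edge F)" by (rule rigid_edge[OF simple])
  \<comment> \<open>The final vertex set is exactly the range of \<open>code\<close>, as isolated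
    extra numbers could be moved by an endomorphism.\<close>
  define code :: "vertex \<Rightarrow> nat" where "code = to_nat"
  have code: "inj_on code UNIV" by (simp add: code_def)
  note simple' = simple_graph_edge[OF simple]
  have "induced_embedding V E UNIV F g"
    unfolding F_def by (rule induced_embedding_image_graph[OF assms(1) g]) simp
  from induced_embedding_comp[OF induced_embedding_comp[OF this induced_embedding_Copy]
      induced_embedding_image_graph[OF simple' code order_refl]]
  show ?thesis
    using simple_graph_image[OF simple' code order_refl] rigid_image_graph[OF simple' rigid code]
    by blast
qed

end
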